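(* Let $F:\mathbb{R}^n\to\mathbb{R}^m$ be continuous, let $\delta\ge 0$, and let $C\in\mathbb{R}^{m\times r}$ with $r\le m$ have full column rank, with QR factorization $C=QR$ where $Q\in\mathbb{R}^{m\times r}$ has orthonormal columns and $R\in\mathbb{R}^{r\times r}$ is diagonal with positive diagonal entries. Let $\Omega=\{y\in\mathbb{R}^r:\|y\|_\infty\le\delta\}$, $f(x,y)=\|F(x)-Cy\|^2$ and $\varphi(x)=\max_{y\in\Omega}f(x,y)$. If $\varphi$ has a minimizer over $\mathbb{R}^n$, then the problem $\min_{x\in\mathbb{R}^n}\max_{y\in\Omega}f(x,y)$ has a global minimax point, and $(x^*,y^* )$ is a global minimax point of this problem for any $$x^*\in\mathop{\mathrm{argmin}}_{x\in\mathbb{R}^n}\varphi(x)\quad\text{and}\quad y^*\in\mathop{\mathrm{argmax}}_{y\in\Omega}f(x^*,y).$$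
   Context: $\|\cdot\|$ is the Euclidean norm and $\|\cdot\|_\infty$ the max norm. A point $(x^*,y^* )\in\mathbb{R}^n\times\Omega$ is a global minimax point of $\min_x\max_{y\in\Omega}f(x,y)$ if $$\max_{y\in\Omega}f(x^*,y)\le f(x^*,y^* )\le\min_{x\in\mathbb{R}^n}\max_{y\in\Omega}f(x,y).$$ *)

theory Defs
  imports "HOL-Analysis.Analysis"
begin

definition orthonormal_columns :: "real^'r^'m \<Rightarrow> bool" where
  "orthonormal_columns Q \<longleftrightarrow>
     (\<forall>i. norm (column i Q) = 1) \<and>
     (\<forall>i j. i \<noteq> j \<longrightarrow> orthogonal (column i Q) (column j Q))"

definition diagonal_matrix :: "real^'r^'r \<Rightarrow> bool" where
  "diagonal_matrix R \<longleftrightarrow> (\<forall>i j. i \<noteq> j \<longrightarrow> R $ i $ j = 0)"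

(* infnorm on real^'r is the max norm, the standard basis being its Basis. *)
definition max_norm_ball :: "real \<Rightarrow> (real^'r) set" where
  "max_norm_ball \<delta> = {y. infnorm y \<le> \<delta>}"

definition objective ::
  "(real^'n \<Rightarrow> real^'m) \<Rightarrow> real^'r^'m \<Rightarrow> real^'n \<Rightarrow> real^'r \<Rightarrow> real" where
  "objective F C x y = (norm (F x - C *v y))\<^sup>2"

definition max_value :: "('x \<Rightarrow> 'y \<Rightarrow> real) \<Rightarrow> 'y set \<Rightarrow> 'x \<Rightarrow> real" where
  "max_value f \<Omega> x = (SUP y\<in>\<Omega>. f x y)"

(* Global minimax point of min over all x, max over y in \<Omega>. Real SUP and INF are
   unspecified on unbounded sets, and "max" and "min" presuppose attainment; the two
   attainment clauses make the extrema in the inequalities genuine maxima and a genuine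
   minimum. *)
definition global_minimax_point ::
  "('x \<Rightarrow> 'y \<Rightarrow> real) \<Rightarrow> 'y set \<Rightarrow> 'x \<Rightarrow> 'y \<Rightarrow> bool" where
  "global_minimax_point f \<Omega> xs ys \<longleftrightarrow>
     ys \<in> \<Omega> \<and>
     (\<forall>x. \<exists>y. is_arg_max (f x) (\<lambda>y. y \<in> \<Omega>) y) \<and>
     (\<exists>x. is_arg_min (max_value f \<Omega>) (\<lambda>x. True) x) \<and>
     max_value f \<Omega> xs \<le> f xs ys \<and>
     f xs ys \<le> (INF x. max_value f \<Omega> x)"

end

theory Submission
  imports Defs
begin

text \<open>
  A minimiser \<open>x\<close> of the max function and a maximiser \<open>y\<close> of \<open>f x\<close> always form a global minimax
  point: the sup defining the max function at \<open>x\<close> is the attained value \<open>f x y\<close>, and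
  that value is the infimum of the max function. The one analytic ingredient is that every inner
  maximum is attained (by continuity in \<open>y\<close> over the compact box); this gives a maximiser at the
  given minimiser, so such a pair exists.
\<close>

text \<open>The box is closed since the max norm is continuous, and bounded since the max norm
  dominates a positive multiple of the Euclidean norm.\<close>

lemma compact_max_norm_ball: "compact (max_norm_ball \<delta> :: (real^'r) set)"
proof -
  let ?B = "max_norm_ball \<delta> :: (real^'r) set"
  have "closed ?B"
    unfolding max_norm_ball_def by (intro closed_Collect_le continuous_intros)
  moreover have "bounded ?B"
  proof (rule boundedI)
    fix y :: "real^'r"
    assume "y \<in> ?B"
    then have "infnorm y \<le> \<delta>" by (simp add: max_norm_ball_def)
    then show "norm y \<le> sqrt DIM(real^'r) * \<delta>"
      by (meson norm_le_infnorm mult_left_mono order_trans real_sqrt_ge_zero of_nat_0_le_iff)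
  qed
  ultimately show ?thesis by (simp add: compact_eq_bounded_closed)
qed

lemma zero_in_max_norm_ball: "\<delta> \<ge> 0 \<Longrightarrow> 0 \<in> max_norm_ball \<delta>"
  by (simp add: max_norm_ball_def infnorm_0)

lemma continuous_on_objective: "continuous_on S (objective F C x)"
  unfolding objective_def
  by (intro continuous_intros linear_continuous_on matrix_vector_mul_bounded_linear)

lemma ex_arg_max_compact:
  fixes g :: "'y::topological_space \<Rightarrow> real"
  assumes "compact \<Omega>" "\<Omega> \<noteq> {}" "continuous_on \<Omega> g"
  shows "\<exists>y. is_arg_max g (\<lambda>y. y \<in> \<Omega>) y"
  using continuous_attains_sup[OF assms] by (auto simp: is_arg_max_linorder)

lemma max_value_eq_arg_max:
  fixes f :: "'x \<Rightarrow> 'y \<Rightarrow> real"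
  assumes "is_arg_max (f x) (\<lambda>y. y \<in> \<Omega>) y"
  shows "max_value f \<Omega> x = f x y"
  using assms unfolding max_value_def
  by (intro cSup_eq_maximum) (auto simp: is_arg_max_linorder)

lemma global_minimax_pointI:
  fixes f :: "'x \<Rightarrow> 'y \<Rightarrow> real"
  assumes attained: "\<And>x. \<exists>y. is_arg_max (f x) (\<lambda>y. y \<in> \<Omega>) y"
    and xs: "is_arg_min (max_value f \<Omega>) (\<lambda>x. True) xs"
    and ys: "is_arg_max (f xs) (\<lambda>y. y \<in> \<Omega>) ys"
  shows "global_minimax_point f \<Omega> xs ys"
proof -
  have val: "max_value f \<Omega> xs = f xs ys"
    using ys by (rule max_value_eq_arg_max)
  have "f xs ys \<le> (INF x. max_value f \<Omega> x)"
    using xs val by (intro cINF_greatest) (auto simp: is_arg_min_linorder)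
  moreover have "ys \<in> \<Omega>"
    using ys by (simp add: is_arg_max_def)
  ultimately show ?thesis
    unfolding global_minimax_point_def using attained xs val order_eq_refl by blast
qed

theorem theorem2p2:
  fixes F :: "real^'n \<Rightarrow> real^'m"
    and C Q :: "real^'r^'m"
    and R :: "real^'r^'r"
    and \<delta> :: real
  assumes "continuous_on UNIV F"
    and "\<delta> \<ge> 0"
    and "CARD('r) \<le> CARD('m)"
    and "rank C = CARD('r)"
    and "C = Q ** R"
    and "orthonormal_columns Q"
    and "diagonal_matrix R"
    and "\<forall>i. R $ i $ i > 0"
    and "\<exists>x. is_arg_min (max_value (objective F C) (max_norm_ball \<delta>)) (\<lambda>x. True) x"
  shows "(\<exists>xs ys. global_minimax_point (objective F C) (max_norm_ball \<delta>) xs ys) \<and>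
    (\<forall>xs ys. is_arg_min (max_value (objective F C) (max_norm_ball \<delta>)) (\<lambda>x. True) xs \<longrightarrow>
       is_arg_max (objective F C xs) (\<lambda>y. y \<in> max_norm_ball \<delta>) ys \<longrightarrow>
       global_minimax_point (objective F C) (max_norm_ball \<delta>) xs ys)"
proof -
  let ?f = "objective F C" and ?B = "max_norm_ball \<delta> :: (real^'r) set"
  have attained: "\<exists>y. is_arg_max (?f x) (\<lambda>y. y \<in> ?B) y" for x
    using zero_in_max_norm_ball[OF \<open>\<delta> \<ge> 0\<close>]
    by (intro ex_arg_max_compact compact_max_norm_ball continuous_on_objective) blast
  have minimax: "global_minimax_point ?f ?B xs ys"
    if "is_arg_min (max_value ?f ?B) (\<lambda>x. True) xs" "is_arg_max (?f xs) (\<lambda>y. y \<in> ?B) ys"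
    for xs ys
    using attained that by (rule global_minimax_pointI)
  then show ?thesis
    using attained assms(9) by blast
qed

end
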